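(* If $\xi \in \mathbb{R} \setminus \mathbb{Q}$ is not a Liouville number, then its density exponent satisfies $\nu(\xi) = 0$.
   Context: A real irrational $\xi$ is a Liouville number if for every $\mu > 0$ there is a rational number $p/q$ (with $q\ge 1$) such that $|\xi - p/q| < q^{-\mu}$. For $\xi \in \mathbb{R}\setminus\mathbb{Q}$ and a non-decreasing sequence $\mathbf{u} = (u_n)_n$ of positive integers, let $v_n$ be the nearest integer to $u_n\xi$ and define $$\alpha_\xi(\mathbf{u}) = \limsup_{n} \frac{|u_{n+1}\xi - v_{n+1}|}{|u_n\xi - v_n|}, \qquad \beta(\mathbf{u}) = \limsup_n \frac{u_{n+1}}{u_n}.$$ The density exponent $\nu(\xi)$ is the infimum of $\log\sqrt{\alpha_\xi(\mathbf{u})\beta(\mathbf{u})}$ over all non-decreasing sequences $\mathbf{u}$ of positive integers with $\alpha_\xi(\mathbf{u}) < 1$ and $\beta(\mathbf{u}) < +\infty$, with the convention $\nu(\xi) = +\infty$ if there is no such $\mathbf{u}$. *)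

theory Defs
  imports "HOL-Analysis.Analysis"
begin

(*
  The denominator is required to be at least 2, as usual in the definition of Liouville numbers.
  If q = 1 were admitted, then p = floor xi would satisfy the inequality for every mu > 0
  and every irrational number would be a Liouville number.
*)
definition liouville_number :: "real \<Rightarrow> bool" where
  "liouville_number \<xi> \<longleftrightarrow> \<xi> \<notin> \<rat> \<and>
     (\<forall>\<mu>::real. \<mu> > 0 \<longrightarrow>
       (\<exists>(p::int) (q::nat). q \<ge> 2 \<and> \<bar>\<xi> - of_int p / real q\<bar> < real q powr (- \<mu>)))"

(*
  If xi is irrational and m > 0, then m * xi is not halfway between two integers,
  so the tie-breaking convention of round is irrelevant.
*)
definition dist_nearest :: "real \<Rightarrow> nat \<Rightarrow> real" where
  "dist_nearest \<xi> m = \<bar>real m * \<xi> - of_int (round (real m * \<xi>))\<bar>"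

definition alpha_exp :: "real \<Rightarrow> (nat \<Rightarrow> nat) \<Rightarrow> ereal" where
  "alpha_exp \<xi> u =
     limsup (\<lambda>n. ereal (dist_nearest \<xi> (u (Suc n)) / dist_nearest \<xi> (u n)))"

definition beta_exp :: "(nat \<Rightarrow> nat) \<Rightarrow> ereal" where
  "beta_exp u = limsup (\<lambda>n. ereal (real (u (Suc n)) / real (u n)))"

(*
  Natural logarithm of a non-negative real with log 0 = -infinity
  (the library has ln 0 = 0, which is not intended here).
*)
definition ext_ln :: "real \<Rightarrow> ereal" where
  "ext_ln x = (if x = 0 then - \<infinity> else ereal (ln x))"

definition admissible :: "real \<Rightarrow> (nat \<Rightarrow> nat) \<Rightarrow> bool" where
  "admissible \<xi> u \<longleftrightarrow>
     mono u \<and> (\<forall>n. u n > 0) \<and> alpha_exp \<xi> u < 1 \<and> beta_exp u < \<infinity>"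

(*
  For admissible u both limits superior are finite and non-negative, so real_of_ereal is exact.
  The infimum of the empty set in ereal is infinity, which is the intended convention.
*)
definition density_exponent :: "real \<Rightarrow> ereal" where
  "density_exponent \<xi> =
     (INF u\<in>{u. admissible \<xi> u}. ext_ln (sqrt (real_of_ereal (alpha_exp \<xi> u * beta_exp u))))"

end

theory Submission
  imports Defs
begin

(*
  Lower bound: if alpha * beta < 1, then u_n * dist (u_n xi) tends to 0. The determinants
  u_n v_(n+1) - u_(n+1) v_n are integers of absolute value O(u_n * dist (u_n xi)), so they
  eventually vanish; then v_n / u_n is eventually constant and equal to xi, which is absurd.

  Upper bound: as alpha < 1, it is enough to make beta close to 1.
  By Dirichlet there is q <= N with e = dist (q xi) < 1/N, and e >= c / N^k as xi is not Liouville.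
  The multiples of q xi therefore come within 1/N of every point modulo 1 before the multiplier
  exceeds about N^(k+1) / c. With N of size r^n and B = r^(k+2) this is o(B^n), so there is
  a u_n in [B^n, B^(n+1)] with dist (u_n xi) in [r^(-n), (1 + eta) r^(-n)], where 1 + eta < r.
*)

section \<open>Distance to the nearest integer\<close>

lemma dist_nearest_pos:
  assumes "\<xi> \<notin> \<rat>" "m > 0"
  shows "dist_nearest \<xi> m > 0"
proof (rule ccontr)
  assume "\<not> ?thesis"
  then have "real m * \<xi> = of_int (round (real m * \<xi>))"
    unfolding dist_nearest_def by simp
  then have "\<xi> = of_int (round (real m * \<xi>)) / real m"
    using assms(2) by (simp add: field_simps)
  then have "\<xi> \<in> \<rat>"
    by (metis Rats_divide Rats_of_int Rats_of_nat)
  with assms(1) show False by simp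
qed

lemma dist_nearest_eqI:
  assumes "0 \<le> real m * \<xi> - of_int v" "real m * \<xi> - of_int v < 1/2"
  shows "dist_nearest \<xi> m = real m * \<xi> - of_int v"
proof -
  have "round (real m * \<xi>) = v"
    by (rule round_unique') (use assms in auto)
  then show ?thesis
    unfolding dist_nearest_def using assms by simp
qed

section \<open>Limits superior of ratios and geometric decay\<close>

lemma tendsto_zero_if_eventually_contracting:
  fixes f :: "nat \<Rightarrow> real"
  assumes "\<And>n. f n \<ge> 0" "c < 1" "\<forall>\<^sub>F n in sequentially. f (Suc n) \<le> c * f n"
  shows "f \<longlonglongrightarrow> 0"
proof -
  obtain N where N: "\<And>n. n \<ge> N \<Longrightarrow> f (Suc n) \<le> c * f n"
    using assms(3) by (auto simp: eventually_sequentially)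
  \<comment> \<open>\<open>c\<close> may be negative; clipping it at 0 lets the estimate be iterated
    and makes the powers tend to 0.\<close>
  define c' where "c' = max c 0"
  have c': "0 \<le> c'" "c' < 1" using assms(2) by (auto simp: c'_def)
  have le: "f (n + N) \<le> f N * c' ^ n" for n
  proof (induction n)
    case (Suc n)
    have "f (Suc n + N) \<le> c * f (n + N)" using N[of "n + N"] by simp
    also have "\<dots> \<le> c' * f (n + N)"
      using assms(1) by (intro mult_right_mono) (auto simp: c'_def)
    also have "\<dots> \<le> c' * (f N * c' ^ n)"
      using Suc c' by (intro mult_left_mono)
    finally show ?case by (simp add: mult_ac)
  qed simp
  have "(\<lambda>n. f N * c' ^ n) \<longlonglongrightarrow> f N * 0"
    using c' by (intro tendsto_mult_left LIMSEQ_realpow_zero)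
  then have "(\<lambda>n. f N * c' ^ n) \<longlonglongrightarrow> 0" by simp
  then have "(\<lambda>n. f (n + N)) \<longlonglongrightarrow> 0"
    by (rule tendsto_sandwich[rotated 3, OF _ ]) (use assms(1) le in auto)
  then show ?thesis by (rule LIMSEQ_offset)
qed

lemma eventually_le_mult_if_limsup_less:
  fixes f :: "nat \<Rightarrow> real"
  assumes "\<And>n. f n > 0" "limsup (\<lambda>n. ereal (f (Suc n) / f n)) < ereal c"
  shows "\<forall>\<^sub>F n in sequentially. f (Suc n) \<le> c * f n"
  using Limsup_lessD[OF assms(2)]
proof eventually_elim
  case (elim n)
  then show ?case using assms(1)[of n] by (simp add: field_simps)
qed

lemma limsup_ratio_nonneg:
  fixes f :: "nat \<Rightarrow> real"
  assumes "\<And>n. f n > 0"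
  shows "limsup (\<lambda>n. ereal (f (Suc n) / f n)) \<ge> 0"
  by (rule le_Limsup) (auto intro!: always_eventually simp: assms less_imp_le)

text \<open>Limits superior bound the ratios only up to some slack. By continuity of the product,
  adding a small \<open>h > 0\<close> to both factors keeps it below 1.\<close>

lemma ex_mult_less_one:
  fixes x y :: real
  assumes "0 \<le> x" "x < 1" "0 \<le> y" "x * y < 1"
  obtains a b where "x < a" "a < 1" "y < b" "a * b < 1"
proof -
  have "((\<lambda>h. (x + h) * (y + h)) \<longlongrightarrow> (x + 0) * (y + 0)) (at_right 0)"
    by (intro tendsto_intros)
  then have "\<forall>\<^sub>F h in at_right 0. (x + h) * (y + h) < 1"
    by (rule order_tendstoD) (use assms in simp)
  moreover have "\<forall>\<^sub>F h in at_right 0. h < 1 - x"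
    using assms by (intro eventually_at_right_real[THEN eventually_mono]) auto
  moreover have "\<forall>\<^sub>F h in at_right (0::real). 0 < h"
    by (simp add: eventually_at_right_less)
  ultimately have "\<forall>\<^sub>F h in at_right 0. (x + h) * (y + h) < 1 \<and> h < 1 - x \<and> 0 < h"
    by eventually_elim auto
  then obtain h where "(x + h) * (y + h) < 1" "h < 1 - x" "0 < h"
    using eventually_happens'[OF trivial_limit_at_right_real] by blast
  then show ?thesis by (intro that[of "x + h" "y + h"]) auto
qed

text \<open>Limits superior of positive ratios are nonnegative and admissibility bounds them above,
  so all later work can take place in the reals.\<close>

lemma ex_real_alpha_beta:
  assumes "\<xi> \<notin> \<rat>" "admissible \<xi> u"
  obtains a b where "alpha_exp \<xi> u = ereal a" "beta_exp u = ereal b" "0 \<le> a" "a < 1" "0 \<le> b"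
proof -
  have pos: "u n > 0" for n using assms(2) by (simp add: admissible_def)
  have "0 \<le> alpha_exp \<xi> u" "alpha_exp \<xi> u < 1"
    using limsup_ratio_nonneg[of "\<lambda>n. dist_nearest \<xi> (u n)"] assms pos
    by (auto simp: alpha_exp_def admissible_def dist_nearest_pos)
  moreover have "0 \<le> beta_exp u" "beta_exp u < \<infinity>"
    using limsup_ratio_nonneg[of "\<lambda>n. real (u n)"] assms pos
    by (auto simp: beta_exp_def admissible_def)
  ultimately show ?thesis
    by (cases "alpha_exp \<xi> u"; cases "beta_exp u") (auto intro: that)
qed

section \<open>Lower bound for the product of the two limits superior\<close>

text \<open>This makes the logarithm in the density exponent nonnegative. In the upper bound it also
  keeps the argument of \<open>ext_ln\<close> away from 0.\<close>

lemma alpha_beta_ge_one: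
  assumes irr: "\<xi> \<notin> \<rat>" and adm: "admissible \<xi> u"
    and x: "alpha_exp \<xi> u = ereal x" and y: "beta_exp u = ereal y"
  shows "x * y \<ge> 1"
proof (rule ccontr)
  assume "\<not> ?thesis"
  then have xy: "x * y < 1" by simp
  obtain x' y' where "alpha_exp \<xi> u = ereal x'" "beta_exp u = ereal y'" "0 \<le> x'" "x' < 1" "0 \<le> y'"
    by (rule ex_real_alpha_beta[OF irr adm])
  then have xy0: "0 \<le> x" "x < 1" "0 \<le> y" using x y by simp_all
  obtain a b where ab: "x < a" "a < 1" "y < b" "a * b < 1"
    using ex_mult_less_one[OF xy0 xy] .
  have upos: "u n > 0" for n using adm by (simp add: admissible_def)
  define d where "d n = dist_nearest \<xi> (u n)" for n
  define v where "v n = round (real (u n) * \<xi>)" for n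
  have dpos: "d n > 0" for n using dist_nearest_pos irr upos by (simp add: d_def)
  have d: "d n = \<bar>real (u n) * \<xi> - of_int (v n)\<bar>" for n
    by (simp add: d_def v_def dist_nearest_def)
  have evd: "\<forall>\<^sub>F n in sequentially. d (Suc n) \<le> a * d n"
    using dpos x ab by (intro eventually_le_mult_if_limsup_less) (auto simp: alpha_exp_def d_def)
  have evu: "\<forall>\<^sub>F n in sequentially. real (u (Suc n)) \<le> b * real (u n)"
    using upos y ab by (intro eventually_le_mult_if_limsup_less) (auto simp: beta_exp_def)
  have lim_d: "d \<longlonglongrightarrow> 0"
    using tendsto_zero_if_eventually_contracting[of d a] ab evd dpos by (simp add: less_imp_le)
  have "\<forall>\<^sub>F n in sequentially. real (u (Suc n)) * d (Suc n) \<le> (a * b) * (real (u n) * d n)"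
    using evd evu
  proof eventually_elim
    case (elim n)
    have "real (u (Suc n)) * d (Suc n) \<le> (b * real (u n)) * (a * d n)"
      using elim dpos[of "Suc n"] ab xy0 by (intro mult_mono) auto
    then show ?case by (simp add: mult_ac)
  qed
  then have lim_ud: "(\<lambda>n. real (u n) * d n) \<longlonglongrightarrow> 0"
    using tendsto_zero_if_eventually_contracting[of "\<lambda>n. real (u n) * d n" "a * b"] ab dpos
    by (simp add: less_imp_le)
  \<comment> \<open>The weight \<open>a + b\<close> anticipates the determinant estimate: its two
    terms are at most \<open>b\<close> and \<open>a\<close> times
    \<open>real (u n) * d n\<close>.\<close>
  then have "(\<lambda>n. (a + b) * (real (u n) * d n)) \<longlonglongrightarrow> (a + b) * 0"
    by (intro tendsto_mult_left)
  then have "\<forall>\<^sub>F n in sequentially. (a + b) * (real (u n) * d n) < 1"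
    by (rule order_tendstoD) simp
  with evd evu have "\<forall>\<^sub>F n in sequentially. int (u n) * v (Suc n) = int (u (Suc n)) * v n"
  proof eventually_elim
    case (elim n)
    \<comment> \<open>In this determinant the terms containing \<open>\<xi>\<close> cancel, so it
      can be rewritten through the two small remainders. Being an integer of absolute value below 1,
      it is 0.\<close>
    define z where "z = int (u n) * v (Suc n) - int (u (Suc n)) * v n"
    have "\<bar>of_int z\<bar> = \<bar>real (u (Suc n)) * (real (u n) * \<xi> - of_int (v n))
        - real (u n) * (real (u (Suc n)) * \<xi> - of_int (v (Suc n)))\<bar>"
      by (simp add: z_def algebra_simps)
    also have "\<dots> \<le> real (u (Suc n)) * d n + real (u n) * d (Suc n)"
      unfolding d by (rule abs_triangle_ineq4[THEN order_trans]) (simp add: abs_mult)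
    also have "\<dots> \<le> (b * real (u n)) * d n + real (u n) * (a * d n)"
      using elim dpos[of n] by (intro add_mono mult_right_mono mult_left_mono) auto
    also have "\<dots> < 1" using elim by (simp add: algebra_simps)
    finally have "z = 0" by linarith
    then show ?case by (simp add: z_def)
  qed
  then obtain N where N: "\<And>n. n \<ge> N \<Longrightarrow> int (u n) * v (Suc n) = int (u (Suc n)) * v n"
    by (auto simp: eventually_sequentially)
  define w where "w n = of_int (v n) / real (u n)" for n
  have w: "w n = w N" if "n \<ge> N" for n
    using that
  proof (induction n rule: dec_induct)
    case (step n)
    have "real (u n) * of_int (v (Suc n)) = real (u (Suc n)) * of_int (v n)"
      using N[OF step(1)] by (metis of_int_mult of_int_of_nat_eq)
    then have "w (Suc n) = w n"
      using upos[of n] upos[of "Suc n"] by (simp add: w_def field_simps)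
    with step show ?case by simp
  qed simp
  \<comment> \<open>Since \<open>u n\<close> is at least 1, clearing the denominator only enlarges
    the error, to \<open>d n\<close>, which tends to 0.\<close>
  have "\<bar>\<xi> - w N\<bar> \<le> d n" if "n \<ge> N" for n
  proof -
    have "\<bar>\<xi> - w n\<bar> \<le> real (u n) * \<bar>\<xi> - w n\<bar>"
      using upos[of n] by (intro mult_le_cancel_right1[THEN iffD2]) auto
    also have "\<dots> = \<bar>real (u n) * (\<xi> - w n)\<bar>" by (simp add: abs_mult)
    also have "\<dots> = d n"
      using upos[of n] by (simp add: d w_def right_diff_distrib)
    finally show ?thesis using w[OF that] by simp
  qed
  then have "\<bar>\<xi> - w N\<bar> \<le> 0"
    using lim_d by (intro LIMSEQ_le_const) auto
  then have "\<xi> = w N" by simp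
  then have "\<xi> \<in> \<rat>" by (simp add: w_def)
  with irr show False by simp
qed

section \<open>Multipliers with prescribed remainder\<close>

text \<open>Negating the definition bounds the error of p/q from below by a power of q; multiplying
  by q only helps. Rounding the exponent up gives ordinary powers.\<close>

lemma not_liouville_lower_bound:
  assumes "\<xi> \<notin> \<rat>" "\<not> liouville_number \<xi>"
  obtains c :: real and k :: nat where "c > 0"
    "\<And>p q. q \<ge> 1 \<Longrightarrow> \<bar>real q * \<xi> - of_int p\<bar> \<ge> c / real q ^ k"
proof -
  obtain \<mu> where \<mu>: "\<mu> > 0"
    "\<And>p q. q \<ge> 2 \<Longrightarrow> \<bar>\<xi> - of_int p / real q\<bar> \<ge> real q powr (- \<mu>)"
    using assms by (auto simp: liouville_number_def not_less)
  define k where "k = nat \<lceil>\<mu>\<rceil>"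
  have k: "\<mu> \<le> real k" by (simp add: k_def real_nat_ceiling_ge)
  \<comment> \<open>The bound \<open>c \<le> 1\<close> serves \<open>q \<ge> 2\<close>; the distance
    serves \<open>q = 1\<close>, which the definition of Liouville numbers leaves out.\<close>
  define c where "c = min 1 (dist_nearest \<xi> 1)"
  have c: "c > 0" "c \<le> 1" using dist_nearest_pos[OF assms(1), of 1] by (auto simp: c_def)
  have "\<bar>real q * \<xi> - of_int p\<bar> \<ge> c / real q ^ k" if "q \<ge> 1" for p q
  proof (cases "q = 1")
    case True
    have "dist_nearest \<xi> 1 \<le> \<bar>\<xi> - of_int p\<bar>"
      using round_diff_minimal[of \<xi> p] by (simp add: dist_nearest_def)
    then show ?thesis using True by (simp add: c_def)
  next
    case False
    with that have q: "q \<ge> 2" by simp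
    have "c / real q ^ k \<le> 1 / real q ^ k" using c q by (intro divide_right_mono) auto
    also have "\<dots> = real q powr (- real k)"
      using q by (simp add: powr_minus powr_realpow divide_inverse)
    also have "\<dots> \<le> real q powr (- \<mu>)" using k q by (intro powr_mono) auto
    also have "\<dots> \<le> 1 * \<bar>\<xi> - of_int p / real q\<bar>" using \<mu>(2)[OF q] by simp
    also have "\<dots> \<le> real q * \<bar>\<xi> - of_int p / real q\<bar>"
      using q by (intro mult_right_mono) auto
    also have "\<dots> = \<bar>real q * (\<xi> - of_int p / real q)\<bar>" by (simp add: abs_mult)
    also have "\<dots> = \<bar>real q * \<xi> - of_int p\<bar>" using q by (simp add: right_diff_distrib)
    finally show ?thesis .
  qed
  with c show ?thesis by (intro that)
qed

text \<open>Steps of length \<open>\<bar>e\<bar>\<close> cannot jump over a half-open arc of that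
  length. For positive \<open>e\<close> the walk climbs from the floor of \<open>s\<close>; for
  negative \<open>e\<close> it descends from the ceiling, written
  \<open>- \<lfloor>- s\<rfloor>\<close>.\<close>

lemma ex_multiple_near_modulo_one:
  fixes e s :: real
  assumes "e \<noteq> 0"
  obtains m :: nat and j :: int where "real m \<le> 1 / \<bar>e\<bar> + 1"
    "s \<le> real m * e + of_int j" "real m * e + of_int j < s + \<bar>e\<bar>"
proof (cases "e > 0")
  case True
  define m where "m = nat \<lceil>frac s / e\<rceil>"
  have "frac s / e \<ge> 0" using True by simp
  then have m: "real m = of_int \<lceil>frac s / e\<rceil>" by (simp add: m_def)
  then have m1: "frac s / e \<le> real m" "real m < frac s / e + 1" by linarith+
  have "frac s / e \<le> 1 / e" using True frac_lt_1[of s] by (intro divide_right_mono) auto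
  with m1 have "real m \<le> 1 / \<bar>e\<bar> + 1" using True by simp
  moreover have "frac s \<le> real m * e" "real m * e < frac s + e"
    using m1 True by (simp_all add: field_simps)
  ultimately show ?thesis
    using True by (intro that[of m "\<lfloor>s\<rfloor>"]) (auto simp: frac_def)
next
  case False
  with assms have e: "e < 0" by simp
  define s' where "s' = frac (- s)"
  define m where "m = nat \<lfloor>s' / \<bar>e\<bar>\<rfloor>"
  have "s' / \<bar>e\<bar> \<ge> 0" by (simp add: s'_def)
  then have m: "real m = of_int \<lfloor>s' / \<bar>e\<bar>\<rfloor>" by (simp add: m_def)
  then have m1: "real m \<le> s' / \<bar>e\<bar>" "s' / \<bar>e\<bar> < real m + 1" by linarith+
  have "s' / \<bar>e\<bar> \<le> 1 / \<bar>e\<bar>"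
    using frac_lt_1[of "- s"] by (intro divide_right_mono) (auto simp: s'_def)
  with m1 have "real m \<le> 1 / \<bar>e\<bar> + 1" by simp
  moreover have "real m * \<bar>e\<bar> \<le> s'" "s' < real m * \<bar>e\<bar> + \<bar>e\<bar>"
    using m1 assms by (simp_all add: field_simps)
  ultimately show ?thesis
    using e by (intro that[of m "- \<lfloor>- s\<rfloor>"]) (auto simp: frac_def s'_def)
qed

text \<open>Starting at \<open>X\<close>, multiples of a Dirichlet denominator
  \<open>Q \<le> N\<close> are added. Each moves the remainder by \<open>e\<close> modulo 1:
  \<open>\<bar>e\<bar> < 1 / N\<close> gives the precision, and the lower bound
  \<open>c / N ^ k\<close> limits the number of steps.\<close>

lemma ex_multiplier_in_short_interval:
  fixes t c :: real
  assumes "c > 0" "N > 0"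
    and low: "\<And>p q. q \<ge> 1 \<Longrightarrow> \<bar>real q * \<xi> - of_int p\<bar> \<ge> c / real q ^ k"
  obtains m :: nat and v :: int where "X \<le> m" "real m \<le> real X + real N * (real N ^ k / c + 1)"
    "t \<le> real m * \<xi> - of_int v" "real m * \<xi> - of_int v \<le> t + 1 / real N"
proof -
  obtain p q where q: "0 < q" "q \<le> int N" and less: "\<bar>of_int q * \<xi> - of_int p\<bar> < 1 / real N"
    using Dirichlet_approx[OF assms(2), of \<xi>] by metis
  define Q where "Q = nat q"
  have Q: "of_int q = real Q" "Q \<ge> 1" "Q \<le> N" using q by (auto simp: Q_def)
  define e where "e = real Q * \<xi> - of_int p"
  have "c / real N ^ k \<le> c / real Q ^ k"
    using Q assms by (intro divide_left_mono power_mono mult_pos_pos zero_less_power) auto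
  also have "\<dots> \<le> \<bar>e\<bar>" using low[OF Q(2)] by (simp add: e_def)
  finally have e_ge: "c / real N ^ k \<le> \<bar>e\<bar>" .
  have pos: "c / real N ^ k > 0" using assms by simp
  then have e0: "e \<noteq> 0" using e_ge by auto
  have "1 / \<bar>e\<bar> \<le> 1 / (c / real N ^ k)"
    using e_ge pos e0 by (intro divide_left_mono mult_pos_pos) auto
  then have e_inv: "1 / \<bar>e\<bar> \<le> real N ^ k / c" by simp
  \<comment> \<open>The target is shifted by \<open>real X * \<xi>\<close> because the walk starts
    at the multiplier \<open>X\<close>.\<close>
  obtain m j where m: "real m \<le> 1 / \<bar>e\<bar> + 1" "t - real X * \<xi> \<le> real m * e + of_int j"
      "real m * e + of_int j < t - real X * \<xi> + \<bar>e\<bar>"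
    using ex_multiple_near_modulo_one[OF e0] by metis
  have eq: "real (X + Q * m) * \<xi> - of_int (int m * p - j) = real X * \<xi> + (real m * e + of_int j)"
    by (simp add: e_def algebra_simps)
  have "real Q * real m \<le> real N * (real N ^ k / c + 1)"
    using Q m e_inv by (intro mult_mono) auto
  then show ?thesis
    using m less eq Q
    by (intro that[of "X + Q * m" "int m * p - j"]) (auto simp: e_def)
qed

section \<open>Admissible sequences with ratios close to 1\<close>

lemma ex_admissible:
  assumes irr: "\<xi> \<notin> \<rat>" and "\<not> liouville_number \<xi>" and "B > 1"
  obtains u where "admissible \<xi> u" "beta_exp u \<le> ereal (B\<^sup>2)"
proof -
  obtain c :: real and k where c: "c > 0"
    and low: "\<And>p q. q \<ge> 1 \<Longrightarrow> \<bar>real q * \<xi> - of_int p\<bar> \<ge> c / real q ^ k"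
    using not_liouville_lower_bound[OF assms(1,2)] by metis
  \<comment> \<open>The search costs a constant times \<open>(r ^ Suc k) ^ n\<close>. The root of
    order \<open>k + 2\<close> makes \<open>B ^ n\<close> larger than that power by a factor
    \<open>r ^ n\<close>, which absorbs all constants.\<close>
  define r where "r = root (Suc (Suc k)) B"
  have r: "r > 1" using assms(3) by (simp add: r_def)
  have B: "B = r ^ Suc (Suc k)"
    unfolding r_def using assms(3) by (intro real_root_pow_pos2[symmetric]) auto
  \<comment> \<open>Halving \<open>r - 1\<close> makes \<open>(1 + \<eta>) / r\<close> strictly less
    than 1; the cap at 1 serves the estimates of \<open>N\<close> and of the remainder.\<close>
  define \<eta> where "\<eta> = min 1 ((r - 1) / 2)"
  have \<eta>: "0 < \<eta>" "\<eta> \<le> 1" "1 + \<eta> < r"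
    using r by (auto simp: \<eta>_def min_def field_simps)
  define D where "D = (2 / \<eta>) ^ Suc k * (1 / c + 1)"
  have D: "D > 0" using c \<eta> by (simp add: D_def add_pos_pos)
  \<comment> \<open>The 5 gives remainders of at most 2/5, so that \<open>v\<close> is the nearest
    integer; the other term lets the search end before \<open>B ^ Suc n\<close>.\<close>
  obtain n0 where "max 5 ((1 + D) / (B - 1)) < r ^ n0"
    using real_arch_pow[OF r] by metis
  then have large: "5 < r ^ n" "(1 + D) / (B - 1) < r ^ n" if "n \<ge> n0" for n
    using less_le_trans[OF _ power_increasing[OF that less_imp_le[OF r]]]
      \<open>max 5 ((1 + D) / (B - 1)) < r ^ n0\<close> by simp_all
  have ex: "\<exists>m v. B ^ n \<le> real m \<and> real m \<le> B ^ Suc n \<and> 1 / r ^ n \<le> real m * \<xi> - of_int v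
      \<and> real m * \<xi> - of_int v \<le> (1 + \<eta>) / r ^ n" if n: "n \<ge> n0" for n
  proof -
    have rn: "r ^ n \<ge> 1" using r by simp
    \<comment> \<open>This makes the precision \<open>1 / N\<close> at most
      \<open>\<eta> / r ^ n\<close>. As \<open>r ^ n / \<eta>\<close> is at least 1, rounding up at
      most doubles it.\<close>
    define N where "N = nat \<lceil>r ^ n / \<eta>\<rceil>"
    have "\<eta> \<le> r ^ n" using rn \<eta> by linarith
    then have "r ^ n / \<eta> \<ge> 1" using \<eta> by (simp add: field_simps)
    then have N: "r ^ n / \<eta> \<le> real N" "real N \<le> (2 / \<eta>) * r ^ n" "N > 0"
      unfolding N_def by (auto simp: field_simps) linarith+
    have "real N * (real N ^ k / c + 1) \<le> real N * (real N ^ k / c + real N ^ k)"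
      using N(3) by (intro mult_left_mono add_left_mono) auto
    also have "\<dots> = real N ^ Suc k * (1 / c + 1)" by (simp add: algebra_simps)
    also have "\<dots> \<le> ((2 / \<eta>) * r ^ n) ^ Suc k * (1 / c + 1)"
      using N c by (intro mult_right_mono power_mono) auto
    also have "\<dots> = D * (r ^ Suc k) ^ n"
      by (simp add: D_def power_mult_distrib power_divide flip: power_mult) (simp add: algebra_simps)
    finally have est: "real N * (real N ^ k / c + 1) \<le> D * (r ^ Suc k) ^ n" .
    define X where "X = nat \<lceil>B ^ n\<rceil>"
    have X: "B ^ n \<le> real X" "real X \<le> B ^ n + 1"
      using assms(3) by (auto simp: X_def real_nat_ceiling_ge)
    obtain m v where m: "X \<le> m" "real m \<le> real X + real N * (real N ^ k / c + 1)"
      "1 / r ^ n \<le> real m * \<xi> - of_int v" "real m * \<xi> - of_int v \<le> 1 / r ^ n + 1 / real N"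
      using ex_multiplier_in_short_interval[OF c N(3) low] by metis
    have R1: "(r ^ Suc k) ^ n \<ge> 1" using r by (intro one_le_power) auto
    have "real m \<le> B ^ n + (1 + D * (r ^ Suc k) ^ n)" using X m est by linarith
    also have "\<dots> \<le> B ^ n + (1 + D) * (r ^ Suc k) ^ n" using R1 by (simp add: algebra_simps)
    \<comment> \<open>By the choice of \<open>n0\<close>, the constant \<open>1 + D\<close> is at
      most \<open>(B - 1) * r ^ n\<close>.\<close>
    also have "\<dots> \<le> B ^ n + ((B - 1) * r ^ n) * (r ^ Suc k) ^ n"
      using large(2)[OF n] assms(3) R1
      by (intro add_left_mono mult_right_mono) (auto simp: field_simps)
    also have "\<dots> = B ^ n + (B - 1) * (r * r ^ Suc k) ^ n"
      by (simp only: power_mult_distrib mult.assoc)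
    also have "\<dots> = B ^ Suc n" unfolding B by (simp add: algebra_simps)
    finally have m_le: "real m \<le> B ^ Suc n" .
    have "1 / real N \<le> 1 / (r ^ n / \<eta>)"
      using N(1) rn \<eta> N(3) by (intro divide_left_mono mult_pos_pos divide_pos_pos) auto
    then have "real m * \<xi> - of_int v \<le> (1 + \<eta>) / r ^ n"
      using m(4) by (simp add: add_divide_distrib)
    with m X m_le show ?thesis by (intro exI[of _ m] exI[of _ v]) auto
  qed
  have "\<exists>m. B ^ n \<le> real m \<and> real m \<le> B ^ Suc n \<and> 1 / r ^ n \<le> dist_nearest \<xi> m
      \<and> dist_nearest \<xi> m \<le> (1 + \<eta>) / r ^ n" if n: "n \<ge> n0" for n
  proof -
    obtain m v where m: "B ^ n \<le> real m" "real m \<le> B ^ Suc n"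
      "1 / r ^ n \<le> real m * \<xi> - of_int v" "real m * \<xi> - of_int v \<le> (1 + \<eta>) / r ^ n"
      using ex[OF n] by blast
    have rn: "r ^ n > 0" using r by simp
    have "(1 + \<eta>) / r ^ n < 1 / 2" using large(1)[OF n] \<eta> rn by (simp add: field_simps)
    moreover have "0 < 1 / r ^ n" using rn by simp
    ultimately have "dist_nearest \<xi> m = real m * \<xi> - of_int v"
      using m by (intro dist_nearest_eqI) linarith+
    with m show ?thesis by auto
  qed
  then have "\<exists>m. B ^ (n + n0) \<le> real m \<and> real m \<le> B ^ Suc (n + n0) \<and> 1 / r ^ (n + n0) \<le> dist_nearest \<xi> m
      \<and> dist_nearest \<xi> m \<le> (1 + \<eta>) / r ^ (n + n0)" for n by simp
  then obtain u where u: "\<And>n. B ^ (n + n0) \<le> real (u n)" "\<And>n. real (u n) \<le> B ^ Suc (n + n0)"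
      "\<And>n. 1 / r ^ (n + n0) \<le> dist_nearest \<xi> (u n)"
      "\<And>n. dist_nearest \<xi> (u n) \<le> (1 + \<eta>) / r ^ (n + n0)"
    by metis
  \<comment> \<open>The intervals for consecutive indices share the endpoint
    \<open>B ^ Suc (n + n0)\<close>.\<close>
  have "u n \<le> u (Suc n)" for n
    using u(2)[of n] u(1)[of "Suc n"] by simp
  then have mono: "mono u" by (simp add: mono_iff_le_Suc)
  have Bpos: "B ^ n > 0" for n using assms(3) by simp
  have upos: "u n > 0" for n using u(1)[of n] Bpos[of "n + n0"] by linarith
  have beta: "real (u (Suc n)) / real (u n) \<le> B\<^sup>2" for n
  proof -
    \<comment> \<open>Two adjacent intervals together span a factor \<open>B\<^sup>2\<close>, hence
      the square.\<close>
    have "real (u (Suc n)) / real (u n) \<le> B ^ Suc (Suc n + n0) / B ^ (n + n0)"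
      using u(1)[of n] u(2)[of "Suc n"] Bpos by (intro frac_le less_imp_le[OF Bpos])
    also have "\<dots> = B\<^sup>2" using assms(3) by (simp add: power2_eq_square)
    finally show ?thesis .
  qed
  have alpha: "dist_nearest \<xi> (u (Suc n)) / dist_nearest \<xi> (u n) \<le> (1 + \<eta>) / r" for n
  proof -
    have "dist_nearest \<xi> (u (Suc n)) / dist_nearest \<xi> (u n)
        \<le> ((1 + \<eta>) / r ^ (Suc n + n0)) / (1 / r ^ (n + n0))"
      using u(3)[of n] u(4)[of "Suc n"] r \<eta> by (intro frac_le) auto
    also have "\<dots> = (1 + \<eta>) / r" using r by simp
    finally show ?thesis .
  qed
  have "alpha_exp \<xi> u \<le> ereal ((1 + \<eta>) / r)"
    unfolding alpha_exp_def using alpha by (intro Limsup_bounded always_eventually) auto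
  also have "\<dots> < 1" using \<eta> r by simp
  finally have "alpha_exp \<xi> u < 1" .
  moreover have beta_le: "beta_exp u \<le> ereal (B\<^sup>2)"
    unfolding beta_exp_def using beta by (intro Limsup_bounded always_eventually) auto
  ultimately have "admissible \<xi> u"
    using mono upos by (auto simp: admissible_def intro: le_less_trans)
  with beta_le show ?thesis by (intro that)
qed

section \<open>The value of the density exponent\<close>

theorem theorem3:
  fixes \<xi> :: real
  assumes "\<xi> \<notin> \<rat>"
    and "\<not> liouville_number \<xi>"
  shows "density_exponent \<xi> = 0"
proof (rule antisym)
  show "density_exponent \<xi> \<le> 0"
  proof (rule ereal_le_epsilon2)
    fix \<epsilon> :: real
    assume \<epsilon>: "0 < \<epsilon>"
    \<comment> \<open>With \<open>B = exp \<epsilon>\<close> the square root turns the bound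
      \<open>B\<^sup>2\<close> on beta into \<open>exp \<epsilon>\<close>; alpha is simply bounded
      by 1.\<close>
    obtain u where u: "admissible \<xi> u" "beta_exp u \<le> ereal ((exp \<epsilon>)\<^sup>2)"
      using ex_admissible[OF assms, of "exp \<epsilon>"] \<epsilon> by auto
    obtain a b where ab: "alpha_exp \<xi> u = ereal a" "beta_exp u = ereal b" "0 \<le> a" "a < 1" "0 \<le> b"
      using ex_real_alpha_beta[OF assms(1) u(1)] by metis
    have "a * b \<ge> 1" using alpha_beta_ge_one[OF assms(1) u(1)] ab by simp
    have "a * b \<le> 1 * (exp \<epsilon>)\<^sup>2" using ab u by (intro mult_mono) auto
    then have "sqrt (a * b) \<le> exp \<epsilon>" by (simp add: real_le_lsqrt)
    then have "ln (sqrt (a * b)) \<le> ln (exp \<epsilon>)"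
      using \<open>a * b \<ge> 1\<close> by (intro ln_mono) auto
    then have "ln (sqrt (a * b)) \<le> \<epsilon>" by simp
    moreover have "density_exponent \<xi> \<le> ext_ln (sqrt (real_of_ereal (alpha_exp \<xi> u * beta_exp u)))"
      unfolding density_exponent_def using u by (intro INF_lower) auto
    ultimately show "density_exponent \<xi> \<le> 0 + ereal \<epsilon>"
      using ab \<open>a * b \<ge> 1\<close> by (auto simp: ext_ln_def intro: order_trans)
  qed
next
  show "0 \<le> density_exponent \<xi>"
    unfolding density_exponent_def
  proof (rule INF_greatest)
    fix u
    assume "u \<in> {u. admissible \<xi> u}"
    then have u: "admissible \<xi> u" by simp
    obtain a b where ab: "alpha_exp \<xi> u = ereal a" "beta_exp u = ereal b"
      using ex_real_alpha_beta[OF assms(1) u] by metis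
    have "a * b \<ge> 1" using alpha_beta_ge_one[OF assms(1) u ab] .
    then show "0 \<le> ext_ln (sqrt (real_of_ereal (alpha_exp \<xi> u * beta_exp u)))"
      using ab by (auto simp: ext_ln_def)
  qed
qed

end
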